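(* Let $M$ be a quasianalytic derivation closed weight sequence such that $m=(M_k/k!)_k$ is log-convex and $m_k^{1/k}\to\infty$. Then the ring ${}_1\mathcal{E}^{(M)}$ has property $(\mathscr{D})$.
   Context: A weight sequence is a sequence $M=(M_k)_{k\ge0}$ of positive reals with $M_k=\mu_1\cdots\mu_k$, $M_0=1$, where $(\mu_k)$ is positive and increasing with $\mu_0=1$, and $M_k^{1/k}\to\infty$. $M$ is quasianalytic if $\sum_{k\ge1}1/\mu_k=\infty$; $M$ is derivation closed if $\exists C>0\ \forall k: M_{k+1}\le C^{k+1}M_k$. For open $U\subseteq\mathbb{R}$ and $\sigma>0$, $\mathcal{B}^M_\sigma(U)$ is the set of $f\in C^\infty(U)$ with $\sup_{x\in U,k\in\mathbb{N}}|f^{(k)}(x)|/(\sigma^{k}M_{k})<\infty$. $\mathcal{E}^{(M)}(U)$ is the set of $f\in C^\infty(U)$ with $f|_V\in\mathcal{B}^M_\sigma(V)$ for every relatively compact open $V\subseteq U$ and every $\sigma>0$. ${}_1\mathcal{E}^{(M)}$ is the ring of germs at $0\in\mathbb{R}$ of complex valued $\mathcal{E}^{(M)}$-functions. A subring $\mathcal{S}$ of the ring of germs at $0\in\mathbb{R}$ of complex valued $C^\infty$ functions has property $(\mathscr{D})$ if for every complex valued function germ $f$ at $0$: if $f^j,f^{j+1}\in\mathcal{S}$ for some integer $j\ge1$, then $f\in\mathcal{S}$. *)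

theory Defs
  imports "HOL-Analysis.Analysis"
begin

definition weight_sequence :: "(nat \<Rightarrow> real) \<Rightarrow> bool" where
  "weight_sequence M \<longleftrightarrow>
     (\<exists>mu::nat \<Rightarrow> real. (\<forall>k. 0 < mu k) \<and> mono mu \<and> mu 0 = 1 \<and>
        (\<forall>k. M k = (\<Prod>i\<in>{1..k}. mu i))) \<and>
     filterlim (\<lambda>k. root k (M k)) at_top sequentially"

definition quasianalytic :: "(nat \<Rightarrow> real) \<Rightarrow> bool" where
  "quasianalytic M \<longleftrightarrow> \<not> summable (\<lambda>k. 1 / (M (Suc k) / M k))"

definition derivation_closed :: "(nat \<Rightarrow> real) \<Rightarrow> bool" where
  "derivation_closed M \<longleftrightarrow> (\<exists>C>0. \<forall>k. M (Suc k) \<le> C ^ Suc k * M k)"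

definition log_convex :: "(nat \<Rightarrow> real) \<Rightarrow> bool" where
  "log_convex m \<longleftrightarrow> (\<forall>k. (m (Suc k))\<^sup>2 \<le> m k * m (Suc (Suc k)))"

definition nth_vderiv :: "nat \<Rightarrow> (real \<Rightarrow> complex) \<Rightarrow> real \<Rightarrow> complex" where
  "nth_vderiv k f = ((\<lambda>g x. vector_derivative g (at x)) ^^ k) f"

definition smooth_on :: "real set \<Rightarrow> (real \<Rightarrow> complex) \<Rightarrow> bool" where
  "smooth_on U f \<longleftrightarrow>
     (\<forall>k. \<forall>x\<in>U. (nth_vderiv k f has_vector_derivative nth_vderiv (Suc k) f x) (at x))"

definition B_M :: "(nat \<Rightarrow> real) \<Rightarrow> real \<Rightarrow> real set \<Rightarrow> (real \<Rightarrow> complex) set" where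
  "B_M M \<sigma> U = {f. smooth_on U f \<and>
     (\<exists>C. \<forall>x\<in>U. \<forall>k. norm (nth_vderiv k f x) / (\<sigma> ^ k * M k) \<le> C)}"

definition E_M :: "(nat \<Rightarrow> real) \<Rightarrow> real set \<Rightarrow> (real \<Rightarrow> complex) set" where
  "E_M M U = {f. smooth_on U f \<and>
     (\<forall>V \<sigma>. open V \<and> V \<subseteq> U \<and> compact (closure V) \<and> closure V \<subseteq> U \<and> \<sigma> > 0
        \<longrightarrow> f \<in> B_M M \<sigma> V)}"

text \<open>The ring of germs at 0 of E^(M) functions, represented as the set of all
  functions whose germ at 0 lies in it (closed under germ equivalence).\<close>
definition germs_E_M :: "(nat \<Rightarrow> real) \<Rightarrow> (real \<Rightarrow> complex) set" where
  "germs_E_M M = {f. \<exists>U. open U \<and> 0 \<in> U \<and> f \<in> E_M M U}"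

definition property_D :: "(real \<Rightarrow> complex) set \<Rightarrow> bool" where
  "property_D S \<longleftrightarrow>
     (\<forall>f::real \<Rightarrow> complex. \<forall>j::nat. j \<ge> 1 \<and> (\<lambda>x. f x ^ j) \<in> S \<and> (\<lambda>x. f x ^ (j+1)) \<in> S
        \<longrightarrow> f \<in> S)"

end

theory Submission
  imports Defs
begin

text \<open>
  If \<open>g = f^j\<close> is flat at \<open>0\<close>, then quasianalyticity forces \<open>g = 0\<close>, hence \<open>f = 0\<close>, near \<open>0\<close>.
  Otherwise divide \<open>f^j\<close> and \<open>f^(j+1)\<close> simultaneously by \<open>x\<close>, which derivation closedness allows,
  until \<open>f^j = x^s G\<close> and \<open>f^(j+1) = x^s H\<close> with \<open>G\<close> nonvanishing at \<open>0\<close>; the relation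
  \<open>H^j = x^s G^(j+1)\<close> makes every such division possible, and finally \<open>f = H / G\<close>.
  A quotient of Beurling class functions stays in the class because log-convexity gives
  \<open>m_k m_(n-k) \<le> m_1 m_(n-1)\<close> for \<open>0 < k < n\<close>, and \<open>m_(n-1) / m_n \<rightarrow> 0\<close>
  absorbs the constants in the recursion for the Taylor coefficients.
  The Denjoy-Carleman uniqueness theorem is proved by Bang's method.
\<close>

section \<open>Jets of Beurling class functions and germs at 0\<close>

text \<open>All derivatives are carried as data, with bounds uniform on a symmetric interval. A
  function built by an integral or a recursion thus comes with formulas for its derivatives, and
  iterating \<open>vector_derivative\<close> is avoided.\<close>

definition ultra_jet :: "(nat \<Rightarrow> real) \<Rightarrow> real \<Rightarrow> (nat \<Rightarrow> real \<Rightarrow> complex) \<Rightarrow> bool" where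
  "ultra_jet M R F \<longleftrightarrow>
     (\<forall>k x. \<bar>x\<bar> < R \<longrightarrow> (F k has_vector_derivative F (Suc k) x) (at x)) \<and>
     (\<forall>\<sigma>>0. \<exists>C. \<forall>k x. \<bar>x\<bar> < R \<longrightarrow> norm (F k x) \<le> C * \<sigma> ^ k * M k)"

lemma ultra_jet_deriv:
  "ultra_jet M R F \<Longrightarrow> \<bar>x\<bar> < R \<Longrightarrow> (F k has_vector_derivative F (Suc k) x) (at x)"
  by (simp add: ultra_jet_def)

lemma ultra_jet_bound:
  assumes "ultra_jet M R F" "\<sigma> > 0" "\<And>k. M k > 0"
  obtains C where "C > 0" "\<And>k x. \<bar>x\<bar> < R \<Longrightarrow> norm (F k x) \<le> C * \<sigma> ^ k * M k"
proof -
  obtain C where C: "\<And>k x. \<bar>x\<bar> < R \<Longrightarrow> norm (F k x) \<le> C * \<sigma> ^ k * M k"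
    using assms(1,2) unfolding ultra_jet_def by blast
  have "norm (F k x) \<le> max C 1 * \<sigma> ^ k * M k" if "\<bar>x\<bar> < R" for k x
    using C[OF that, of k] assms(2,3)
    by (smt (verit, best) mult_right_mono zero_less_power less_imp_le)
  then show ?thesis using that[of "max C 1"] by simp
qed

lemma ultra_jet_mono: "ultra_jet M R F \<Longrightarrow> r \<le> R \<Longrightarrow> ultra_jet M r F"
  unfolding ultra_jet_def by (meson order_less_le_trans)

lemma ultra_jet_isCont: "ultra_jet M R F \<Longrightarrow> \<bar>x\<bar> < R \<Longrightarrow> isCont (F k) x"
  by (meson has_vector_derivative_continuous ultra_jet_deriv)

lemma nth_vderiv_eq_jet:
  fixes F :: "nat \<Rightarrow> real \<Rightarrow> complex"
  assumes "\<And>k x. x \<in> U \<Longrightarrow> (F k has_vector_derivative F (Suc k) x) (at x)"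
    and "open U" "\<And>x. x \<in> U \<Longrightarrow> f x = F 0 x" "x \<in> U"
  shows "nth_vderiv k f x = F k x"
  using \<open>x \<in> U\<close>
proof (induction k arbitrary: x)
  case 0
  then show ?case by (simp add: nth_vderiv_def assms)
next
  case (Suc k)
  have "(nth_vderiv k f has_vector_derivative F (Suc k) x) (at x)"
    by (rule has_vector_derivative_transform_within_open[OF assms(1) \<open>open U\<close>])
      (use Suc in auto)
  then show ?case
    by (simp add: nth_vderiv_def vector_derivative_at)
qed

text \<open>Shrinking \<open>U\<close> to a ball with closure inside \<open>U\<close> turns the
  bounds on relatively compact subsets into bounds on a whole interval; conversely, bounds on the
  interval restrict to every subset.\<close>

lemma germs_E_M_iff_ultra_jet:
  assumes M: "\<And>k. M k > 0"
  shows "f \<in> germs_E_M M \<longleftrightarrow>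
    (\<exists>R>0. \<exists>F. ultra_jet M R F \<and> (\<forall>x. \<bar>x\<bar> < R \<longrightarrow> f x = F 0 x))" (is "_ \<longleftrightarrow> ?r")
proof
  assume "f \<in> germs_E_M M"
  then obtain U where U: "open U" "0 \<in> U" "f \<in> E_M M U"
    by (auto simp: germs_E_M_def)
  obtain R where R: "R > 0" "cball 0 R \<subseteq> U"
    using U open_contains_cball by blast
  have "f \<in> B_M M \<sigma> (ball 0 R)" if "\<sigma> > 0" for \<sigma>
  proof -
    have "ball 0 R \<subseteq> U" using R ball_subset_cball by blast
    then show ?thesis using U(3) R that unfolding E_M_def by simp
  qed
  then have b: "\<exists>C. \<forall>k x. \<bar>x\<bar> < R \<longrightarrow> norm (nth_vderiv k f x) / (\<sigma> ^ k * M k) \<le> C"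
    if "\<sigma> > 0" for \<sigma>
    using that by (fastforce simp: B_M_def)
  have "ultra_jet M R (\<lambda>k. nth_vderiv k f)"
    unfolding ultra_jet_def
  proof (intro conjI allI impI)
    fix k x assume "\<bar>x::real\<bar> < R"
    then have "x \<in> U" using R by auto
    then show "(nth_vderiv k f has_vector_derivative nth_vderiv (Suc k) f x) (at x)"
      using U(3) by (auto simp: E_M_def smooth_on_def)
  next
    fix \<sigma> :: real assume "\<sigma> > 0"
    with b[OF this] M show "\<exists>C. \<forall>k x. \<bar>x\<bar> < R \<longrightarrow> norm (nth_vderiv k f x) \<le> C * \<sigma> ^ k * M k"
      by (auto simp: divide_le_eq mult.assoc)
  qed
  then show ?r using R by (intro exI[of _ R]) (auto simp: nth_vderiv_def intro!: exI[of _ "\<lambda>k. nth_vderiv k f"])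
next
  assume ?r
  then obtain R F where R: "R > 0" and F: "ultra_jet M R F" and f: "\<And>x. \<bar>x\<bar> < R \<Longrightarrow> f x = F 0 x"
    by blast
  have eq: "nth_vderiv k f x = F k x" if "x \<in> ball 0 R" for k x
    by (rule nth_vderiv_eq_jet[of "ball 0 R"]) (use F f that in \<open>auto simp: ultra_jet_def\<close>)
  have sm: "smooth_on (ball 0 R) f"
    unfolding smooth_on_def
  proof (intro allI ballI)
    fix k and x :: real assume x: "x \<in> ball 0 R"
    show "(nth_vderiv k f has_vector_derivative nth_vderiv (Suc k) f x) (at x)"
      by (rule has_vector_derivative_transform_within_open[of "F k" _ _ "ball 0 R"])
        (use eq x F in \<open>auto simp: ultra_jet_def\<close>)
  qed
  have "f \<in> B_M M \<sigma> V" if "V \<subseteq> ball 0 R" "\<sigma> > 0" for \<sigma> V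
  proof -
    obtain C where C: "\<And>k x. \<bar>x\<bar> < R \<Longrightarrow> norm (F k x) \<le> C * \<sigma> ^ k * M k"
      using F \<open>\<sigma> > 0\<close> unfolding ultra_jet_def by blast
    have "norm (nth_vderiv k f x) / (\<sigma> ^ k * M k) \<le> C" if "x \<in> V" for x k
      using C[of x k] that \<open>V \<subseteq> _\<close> eq[of x k] M[of k] \<open>\<sigma> > 0\<close>
      by (auto simp: divide_le_eq mult.assoc subset_iff)
    then show ?thesis using sm that by (auto simp: B_M_def smooth_on_def)
  qed
  then have "f \<in> E_M M (ball 0 R)" using sm by (auto simp: E_M_def)
  then show "f \<in> germs_E_M M" using R by (auto simp: germs_E_M_def intro!: exI[of _ "ball 0 R"])
qed

section \<open>Denjoy-Carleman uniqueness\<close>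

text \<open>
  Replaces Taylor's formula in Bang's argument: going down from the order \<open>N + 1\<close>, where the
  global bound suffices, each derivative is compared with an exponential majorant of rate
  \<open>E = e mu_(N+1)\<close>.
\<close>

lemma bang_step:
  fixes F :: "nat \<Rightarrow> real \<Rightarrow> complex"
  assumes der: "\<And>k x. 0 \<le> x \<Longrightarrow> x < R \<Longrightarrow> (F k has_vector_derivative F (Suc k) x) (at x)"
    and bnd: "\<And>k x. 0 \<le> x \<Longrightarrow> x < R \<Longrightarrow> norm (F k x) \<le> C * M k"
    and pos: "C > 0" "\<And>k. mu k > 0" "\<And>k. M k > 0"
    and M: "\<And>k. M (Suc k) = mu (Suc k) * M k" and mono: "mono mu"
    and x: "0 \<le> x" "0 \<le> h" "x + h < R" "h \<le> 1 / (exp 1 * mu (Suc N))"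
    and start: "\<And>j. norm (F j x) \<le> C * exp (real j - real (Suc N)) * M j"
  shows "norm (F j (x + h)) \<le> C * exp (real j - real N) * M j"
proof -
  define E where "E = exp 1 * mu (Suc N)"
  have E: "E > 0" using pos by (simp add: E_def)
  define \<phi> where "\<phi> = (\<lambda>j t. C * exp (real j - real (Suc N)) * M j * exp (E * t))"
  have \<phi>: "norm (F j (x + t)) \<le> \<phi> j t" if "j \<le> Suc N" "0 \<le> t" "x + t < R" for j t
    using that
  proof (induction arbitrary: t rule: inc_induct)
    case base
    have "norm (F (Suc N) (x + t)) \<le> C * M (Suc N) * 1" using bnd base x by simp
    also have "\<dots> \<le> C * M (Suc N) * exp (E * t)"
      using E base pos by (intro mult_left_mono) (auto simp: less_imp_le)
    finally show ?case by (simp add: \<phi>_def)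
  next
    case (step n)
    define K where "K = C * exp (real n - real (Suc N)) * M n"
    have K: "K > 0" using pos by (simp add: K_def)
    \<comment> \<open>Raising the order from \<open>n\<close> to \<open>n + 1\<close> multiplies the
      majorant by \<open>e mu_(n+1)\<close>, at most \<open>E\<close> by monotonicity. So the
      majorant at order \<open>n + 1\<close> is dominated by the derivative of the one at order
      \<open>n\<close>.\<close>
    have le: "\<phi> (Suc n) s \<le> K * E * exp (E * s)" for s
    proof -
      have "mu (Suc n) \<le> mu (Suc N)" using step mono by (auto simp: mono_def)
      then have "C * exp (real n - real (Suc N)) * exp 1 * mu (Suc n) * M n * exp (E * s)
         \<le> C * exp (real n - real (Suc N)) * exp 1 * mu (Suc N) * M n * exp (E * s)"
        using pos by (intro mult_right_mono mult_left_mono) (auto simp: less_imp_le)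
      moreover have "exp (real (Suc n) - real (Suc N)) = exp (real n - real (Suc N)) * exp 1"
        by (simp flip: exp_add add: algebra_simps)
      ultimately show ?thesis by (simp add: \<phi>_def K_def E_def M mult_ac)
    qed
    have "norm (F n (x + t) - F n (x + 0)) \<le> K * exp (E * t) - K * exp (E * 0)"
    proof (cases "t = 0")
      case False
      then have "t > 0" using step by simp
      have d: "((\<lambda>s. F n (x + s)) has_vector_derivative F (Suc n) (x + s)) (at s)"
        if "0 \<le> s" "s \<le> t" for s
      proof -
        have "((\<lambda>s. x + s) has_vector_derivative 1) (at s)"
          by (auto intro!: derivative_eq_intros)
        moreover have "(F n has_vector_derivative F (Suc n) (x + s)) (at (x + s))"
          using der[of "x + s" n] that x step by simp
        ultimately show ?thesis
          using vector_diff_chain_at[of "\<lambda>s. x + s" 1 s "F n" "F (Suc n) (x + s)"]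
          by (simp add: o_def)
      qed
      have c: "continuous_on {0..t} (\<lambda>s. F n (x + s))"
        using d by (intro continuous_at_imp_continuous_on) (metis atLeastAtMost_iff has_vector_derivative_continuous)
      show ?thesis
      proof (rule differentiable_bound_general[OF \<open>t > 0\<close> c])
        show "continuous_on {0..t} (\<lambda>s. K * exp (E * s))" by (intro continuous_intros)
        fix s assume s: "0 < s" "s < t"
        show "((\<lambda>s. F n (x + s)) has_vector_derivative F (Suc n) (x + s)) (at s)"
          using d s by simp
        show "((\<lambda>s. K * exp (E * s)) has_vector_derivative K * E * exp (E * s)) (at s)"
          by (auto simp flip: has_real_derivative_iff_has_vector_derivative intro!: derivative_eq_intros)
        show "norm (F (Suc n) (x + s)) \<le> K * E * exp (E * s)"
          using step.IH[of s] s step.prems le[of s] by linarith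
      qed
    qed simp
    moreover have "norm (F n x) \<le> K" using start by (simp add: K_def)
    ultimately show ?case
      using norm_triangle_ineq2[of "F n (x + t)" "F n x"] by (simp add: \<phi>_def K_def)
  qed
  \<comment> \<open>Over a step of length at most \<open>1 / E\<close> the majorant grows by at most
    a factor \<open>e\<close>, which turns \<open>Suc N\<close> into \<open>N\<close> in the
    exponent.\<close>
  have Eh: "E * h \<le> 1" using x E by (simp add: E_def field_simps)
  show ?thesis
  proof (cases "j \<le> Suc N")
    case True
    have "norm (F j (x + h)) \<le> C * exp (real j - real (Suc N)) * M j * exp (E * h)"
      using \<phi>[OF True, of h] x by (simp add: \<phi>_def)
    also have "\<dots> \<le> C * exp (real j - real (Suc N)) * M j * exp 1"
      using Eh pos by (intro mult_left_mono) (auto simp: less_imp_le)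
    also have "\<dots> = C * exp (real j - real N) * M j"
      by (simp add: mult_ac flip: exp_add)
    finally show ?thesis .
  next
    case False
    have "norm (F j (x + h)) \<le> C * M j * 1" using bnd x by simp
    also have "\<dots> \<le> C * M j * exp (real j - real N)"
      using False pos by (intro mult_left_mono) (auto simp: less_imp_le)
    finally show ?thesis by (simp add: mult_ac)
  qed
qed

text \<open>
  At \<open>0\<close> the bound with factor \<open>e^(-n)\<close> holds for every \<open>n\<close>; it loses one factor \<open>e\<close> along each
  interval of length \<open>1 / (e mu_i)\<close>, and by divergence the loss from \<open>n\<close> down to a fixed \<open>k\<close>
  takes arbitrarily long.
\<close>

lemma denjoy_carleman_right:
  fixes F :: "nat \<Rightarrow> real \<Rightarrow> complex"
  assumes der: "\<And>k x. 0 \<le> x \<Longrightarrow> x < R \<Longrightarrow> (F k has_vector_derivative F (Suc k) x) (at x)"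
    and bnd: "\<And>k x. 0 \<le> x \<Longrightarrow> x < R \<Longrightarrow> norm (F k x) \<le> C * M k"
    and pos: "C > 0" "\<And>k. mu k > 0" "\<And>k. M k > 0"
    and M: "\<And>k. M (Suc k) = mu (Suc k) * M k" and mono: "mono mu"
    and div: "\<not> summable (\<lambda>k. 1 / mu (Suc k))"
    and flat: "\<And>k. F k 0 = 0"
    and x: "0 \<le> x" "x < R"
  shows "F 0 x = 0"
proof -
  \<comment> \<open>The distance over which the factor \<open>e^(-n)\<close> is allowed to weaken to
    \<open>e^(-k)\<close>.\<close>
  define T where "T = (\<lambda>k n. \<Sum>i=k..<n. 1 / (exp 1 * mu (Suc i)))"
  have T: "norm (F j y) \<le> C * exp (real j - real k) * M j"
    if "k \<le> n" "0 \<le> y" "y \<le> T k n" "y < R" for j k n y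
    using that
  proof (induction arbitrary: y j rule: inc_induct)
    case base
    then have "y = 0" by (simp add: T_def)
    then show ?case using pos by (simp add: flat less_imp_le)
  next
    case (step k)
    have Tk: "T k n = 1 / (exp 1 * mu (Suc k)) + T (Suc k) n"
      using step.hyps by (simp add: T_def sum.atLeast_Suc_lessThan)
    have T0: "T (Suc k) n \<ge> 0" using pos by (force simp: T_def intro!: sum_nonneg intro: less_imp_le)
    \<comment> \<open>\<open>z\<close> is the part of the way covered by the induction hypothesis;
      what remains is at most one interval.\<close>
    define z where "z = min y (T (Suc k) n)"
    have z: "0 \<le> z" "z \<le> T (Suc k) n" "z \<le> y" using T0 step.prems by (auto simp: z_def)
    have h: "y - z \<le> 1 / (exp 1 * mu (Suc k))"
    proof -
      have "0 \<le> 1 / (exp 1 * mu (Suc k))" using pos(2) by (simp add: less_imp_le)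
      then show ?thesis using Tk step.prems unfolding z_def by linarith
    qed
    have "norm (F j (z + (y - z))) \<le> C * exp (real j - real k) * M j"
      by (rule bang_step[OF der bnd pos M mono, where R = R])
        (use z h step.prems step.IH[OF z(1,2)] in auto)
    then show ?case by simp
  qed
  \<comment> \<open>If these distances stayed below \<open>y\<close>, a tail of the sum of
    \<open>1 / mu\<close> would converge.\<close>
  have large: "\<exists>n\<ge>k. y \<le> T k n" for k y
  proof (rule ccontr)
    assume *: "\<not> ?thesis"
    have "summable (\<lambda>i. 1 / (exp 1 * mu (Suc (i + k))))"
    proof (rule bounded_imp_summable[of _ y])
      fix n
      have "(\<Sum>i\<le>n. 1 / (exp 1 * mu (Suc (i + k)))) = (\<Sum>i=0 + k..<Suc n + k. 1 / (exp 1 * mu (Suc i)))"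
        by (subst sum.shift_bounds_nat_ivl) (simp only: atLeast0LessThan lessThan_Suc_atMost)
      also have "\<dots> = T k (Suc n + k)" by (simp add: T_def)
      also have "T k (Suc n + k) \<le> y" using *[simplified] by (meson le_add2 less_imp_le not_le)
      finally show "(\<Sum>i\<le>n. 1 / (exp 1 * mu (Suc (i + k)))) \<le> y" .
    qed (use pos in \<open>auto intro: less_imp_le\<close>)
    then have "summable (\<lambda>i. exp 1 * (1 / (exp 1 * mu (Suc (i + k)))))"
      by (rule summable_mult)
    then have "summable (\<lambda>i. 1 / mu (Suc (i + k)))" by simp
    then show False using div summable_iff_shift[where f="\<lambda>i. 1 / mu (Suc i)" and k=k] by simp
  qed
  \<comment> \<open>For each \<open>k\<close>, some \<open>n\<close> is large enough for
    \<open>T k n\<close> to reach \<open>x\<close>; then \<open>k\<close> tends to infinity.\<close>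
  have bound: "norm (F 0 x) \<le> C * M 0 * exp (- real k)" for k
    using large[where k=k and y=x] T[where k=k and y=x and j=0] x by (auto simp: mult_ac)
  have "(\<lambda>k. C * M 0 * exp (- real k)) \<longlonglongrightarrow> C * M 0 * 0"
    by (intro tendsto_mult tendsto_const filterlim_compose[OF exp_at_bot]
        filterlim_compose[OF filterlim_uminus_at_bot_at_top filterlim_real_sequentially])
  then have "norm (F 0 x) \<le> 0"
    using bound by (intro LIMSEQ_le_const) auto
  then show ?thesis by simp
qed

text \<open>Negative \<open>x\<close> reduces to the one-sided result by the reflection
  \<open>t -> -t\<close>, which multiplies the \<open>k\<close>-th derivative by
  \<open>(-1)^k\<close> and preserves both bounds and flatness.\<close>

lemma denjoy_carleman:
  assumes F: "ultra_jet M R F"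
    and M: "M 0 = 1" "\<And>k. M (Suc k) = mu (Suc k) * M k"
    and mu: "\<And>k. mu k > 0" "mono mu" "\<not> summable (\<lambda>k. 1 / mu (Suc k))"
    and flat: "\<And>k. F k 0 = 0"
    and x: "\<bar>x\<bar> < R"
  shows "F 0 x = 0"
proof -
  have Mpos: "M k > 0" for k
    by (induction k) (use M mu in auto)
  obtain C where C: "C > 0" "\<And>k x. \<bar>x\<bar> < R \<Longrightarrow> norm (F k x) \<le> C * M k"
    using ultra_jet_bound[OF F, of 1] Mpos by auto
  define s :: real where "s = (if x \<ge> 0 then 1 else -1)"
  define G where "G = (\<lambda>k t. of_real (s ^ k) * F k (s * t))"
  have s: "\<bar>s\<bar> = 1" by (simp add: s_def)
  have "G 0 \<bar>x\<bar> = 0"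
  proof (rule denjoy_carleman_right[where F = G and R = R and C = C and M = M and mu = mu])
    fix k t assume t: "0 \<le> t" "t < R"
    then have st: "\<bar>s * t\<bar> < R" by (simp add: abs_mult s)
    have "((\<lambda>t. s * t) has_vector_derivative s) (at t)"
      by (auto intro!: derivative_eq_intros)
    from vector_diff_chain_at[OF this ultra_jet_deriv[OF F st, of k]]
    have "((\<lambda>t. F k (s * t)) has_vector_derivative s *\<^sub>R F (Suc k) (s * t)) (at t)"
      by (simp add: o_def)
    from has_vector_derivative_mult_right[OF this, of "of_real (s ^ k)"]
    show "(G k has_vector_derivative G (Suc k) t) (at t)"
      by (simp add: G_def scaleR_conv_of_real mult_ac)
    show "norm (G k t) \<le> C * M k"
      using C(2)[OF st] s by (simp add: G_def norm_mult norm_power power_abs)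
  qed (use C Mpos mu M flat x in \<open>auto simp: G_def\<close>)
  then show ?thesis by (auto simp: G_def s_def split: if_splits)
qed

section \<open>Division by x\<close>

text \<open>Hadamard's lemma: \<open>Q 0 x\<close> is the integral of \<open>F 1 (t x)\<close> over
  \<open>t\<close> in [0,1], and differentiation under the integral gives the other
  \<open>Q k\<close>. The order rises by one, which derivation closedness pays for. The values at 0
  track a nonvanishing derivative through repeated division.\<close>

lemma ultra_jet_divide_x:
  assumes F: "ultra_jet M R F" and F0: "F 0 0 = 0" and R: "R > 0"
    and M: "\<And>k. M k > 0" and dc: "derivation_closed M"
  obtains Q where "ultra_jet M R Q"
    "\<And>x. \<bar>x\<bar> < R \<Longrightarrow> F 0 x = of_real x * Q 0 x"
    "\<And>k. Q k 0 = F (Suc k) 0 / of_nat (Suc k)"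
proof -
  define Q where "Q = (\<lambda>k x. integral (cbox 0 1) (\<lambda>t. of_real (t ^ k) * F (Suc k) (t * x)))"
  have tx: "\<bar>t * x\<bar> < R" if "\<bar>x\<bar> < R" "t \<in> {0..1}" for t x :: real
    using that mult_left_le_one_le[of "\<bar>x\<bar>" t] by (auto simp: abs_mult)
  then have tx': "t * x \<in> {-R<..<R}" if "x \<in> {-R<..<R}" "t \<in> {0..1}" for t x :: real
    using that by (fastforce simp: abs_less_iff)
  have cF: "continuous_on {-R<..<R} (F k)" for k
    using ultra_jet_isCont[OF F] by (intro continuous_at_imp_continuous_on) auto
  have cont2: "continuous_on ({-R<..<R} \<times> cbox 0 1) (\<lambda>(x, t). of_real (t ^ k) * F l (t * x))" for k l
    unfolding split_beta
    by (intro continuous_intros continuous_on_compose2[OF cF]) (use tx' in auto)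
  have cont1: "continuous_on {0..1} (\<lambda>t. of_real (t ^ k) * F l (t * x))" if "\<bar>x\<bar> < R" for k l x
    by (intro continuous_intros continuous_on_compose2[OF cF]) (use tx'[of x] that in \<open>auto simp: abs_less_iff\<close>)
  have dt: "((\<lambda>x. F k (t * x)) has_vector_derivative t *\<^sub>R F (Suc k) (t * x)) (at x)"
    if "\<bar>x\<bar> < R" "t \<in> {0..1}" for k t x
  proof -
    have "((\<lambda>x. t * x) has_vector_derivative t) (at x)"
      by (auto intro!: derivative_eq_intros)
    from vector_diff_chain_at[OF this ultra_jet_deriv[OF F tx[OF that], of k]]
    show ?thesis by (simp add: o_def)
  qed
  have der: "(Q k has_vector_derivative Q (Suc k) x) (at x)" if x: "\<bar>x\<bar> < R" for k x
  proof -
    have "(Q k has_vector_derivative Q (Suc k) x) (at x within {-R<..<R})"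
      unfolding Q_def
    proof (rule leibniz_rule_vector_derivative[where fx = "\<lambda>x t. of_real (t ^ Suc k) * F (Suc (Suc k)) (t * x)"])
      fix y t :: real assume yt: "y \<in> {-R<..<R}" "t \<in> cbox 0 1"
      then have "((\<lambda>x. F (Suc k) (t * x)) has_vector_derivative t *\<^sub>R F (Suc (Suc k)) (t * y)) (at y)"
        by (intro dt) auto
      note d = has_vector_derivative_mult_right[OF this, of "of_real (t ^ k)"]
      have eq: "of_real (t ^ k) * t *\<^sub>R z = of_real (t ^ Suc k) * z" for z :: complex
        by (simp add: scaleR_conv_of_real)
      show "((\<lambda>x. of_real (t ^ k) * F (Suc k) (t * x)) has_vector_derivative
              of_real (t ^ Suc k) * F (Suc (Suc k)) (t * y)) (at y within {-R<..<R})"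
        using has_vector_derivative_at_within[OF d] by (simp only: eq)
    next
      fix y :: real assume "y \<in> {-R<..<R}"
      then show "(\<lambda>t. of_real (t ^ k) * F (Suc k) (t * y)) integrable_on cbox 0 1"
        using cont1[of y k "Suc k"] by (intro integrable_continuous) auto
    next
      show "continuous_on ({-R<..<R} \<times> cbox 0 1) (\<lambda>(x, t). of_real (t ^ Suc k) * F (Suc (Suc k)) (t * x))"
        by (rule cont2)
    qed (use x in auto)
    then show ?thesis using x by (simp add: at_within_open[of x "{-R<..<R}"] abs_less_iff)
  qed
  have bnd: "norm (Q k x) \<le> B" if "\<bar>x\<bar> < R" "\<And>y. \<bar>y\<bar> < R \<Longrightarrow> norm (F (Suc k) y) \<le> B" for k x B
  proof -
    have "norm (integral {0..1} (\<lambda>t. of_real (t ^ k) * F (Suc k) (t * x))) \<le> B * (1 - 0)"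
    proof (rule integral_bound[OF _ cont1[OF that(1)]])
      fix t :: real assume t: "t \<in> {0..1}"
      have "norm (of_real (t ^ k) * F (Suc k) (t * x)) \<le> 1 * B"
        unfolding norm_mult using t that(2)[OF tx[OF that(1) t]]
        by (intro mult_mono) (auto simp: norm_power power_le_one)
      then show "norm (of_real (t ^ k) * F (Suc k) (t * x)) \<le> B" by simp
    qed simp
    then show ?thesis by (simp add: Q_def)
  qed
  obtain D where D: "D > 0" "\<And>k. M (Suc k) \<le> D ^ Suc k * M k"
    using dc unfolding derivation_closed_def by blast
  have "ultra_jet M R Q"
    unfolding ultra_jet_def
  proof (intro conjI allI impI)
    fix \<sigma> :: real assume \<sigma>: "\<sigma> > 0"
    \<comment> \<open>The scale \<open>\<sigma> / D\<close> cancels the factor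
      \<open>D ^ Suc k\<close> from derivation closedness; one spare \<open>\<sigma>\<close> goes
      into the constant.\<close>
    obtain C where C: "C > 0" "\<And>k x. \<bar>x\<bar> < R \<Longrightarrow> norm (F k x) \<le> C * (\<sigma> / D) ^ k * M k"
      using ultra_jet_bound[OF F, of "\<sigma> / D"] \<sigma> D M by (metis divide_pos_pos)
    have "norm (Q k x) \<le> C * \<sigma> * \<sigma> ^ k * M k" if "\<bar>x\<bar> < R" for k x
    proof (rule bnd[OF that])
      fix y assume "\<bar>y\<bar> < R"
      then have "norm (F (Suc k) y) \<le> C * (\<sigma> / D) ^ Suc k * M (Suc k)" by (rule C)
      also have "\<dots> \<le> C * (\<sigma> / D) ^ Suc k * (D ^ Suc k * M k)"
        using C \<sigma> D by (intro mult_left_mono D) auto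
      also have "\<dots> = C * \<sigma> * \<sigma> ^ k * M k" using D by (simp add: power_divide)
      finally show "norm (F (Suc k) y) \<le> C * \<sigma> * \<sigma> ^ k * M k" .
    qed
    then show "\<exists>C. \<forall>k x. \<bar>x\<bar> < R \<longrightarrow> norm (Q k x) \<le> C * \<sigma> ^ k * M k" by blast
  qed (use der in auto)
  moreover have "F 0 x = of_real x * Q 0 x" if x: "\<bar>x\<bar> < R" for x
  proof -
    have "((\<lambda>t. x *\<^sub>R F (Suc 0) (t * x)) has_integral F 0 (1 * x) - F 0 (0 * x)) {0..1}"
    proof (rule fundamental_theorem_of_calculus)
      fix t :: real assume t: "t \<in> {0..1}"
      have "((\<lambda>t. t * x) has_vector_derivative x) (at t)"
        by (auto intro!: derivative_eq_intros)
      note d = vector_diff_chain_at[OF this ultra_jet_deriv[OF F tx[OF x t], of 0]]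
      show "((\<lambda>t. F 0 (t * x)) has_vector_derivative x *\<^sub>R F (Suc 0) (t * x)) (at t within {0..1})"
        using has_vector_derivative_at_within[OF d] by (simp add: o_def)
    qed simp
    from integral_unique[OF this] have "F 0 x = integral {0..1} (\<lambda>t. x *\<^sub>R F (Suc 0) (t * x))"
      using F0 by simp
    then show ?thesis by (simp add: Q_def scaleR_conv_of_real)
  qed
  moreover have "Q k 0 = F (Suc k) 0 / of_nat (Suc k)" for k
  proof -
    have "((\<lambda>t. of_real (t ^ k)) has_integral of_real (1 ^ Suc k / (Suc k)) - complex_of_real (0 ^ Suc k / (Suc k))) {0..1}"
    proof (rule fundamental_theorem_of_calculus)
      fix t :: real
      have "((\<lambda>t. t ^ Suc k / (Suc k)) has_real_derivative t ^ k) (at t within {0..1})"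
        by (rule derivative_eq_intros refl | simp)+
      then show "((\<lambda>t. complex_of_real (t ^ Suc k / (Suc k))) has_vector_derivative of_real (t ^ k)) (at t within {0..1})"
        by (intro has_vector_derivative_of_real)
    qed simp
    then have "integral {0..1} (\<lambda>t. of_real (t ^ k) :: complex) = 1 / of_nat (Suc k)"
      by (simp add: integral_unique)
    then show ?thesis by (simp add: Q_def)
  qed
  ultimately show ?thesis using that by blast
qed

section \<open>Log-convex sequences and quotients\<close>

text \<open>Log-convexity makes the ratios \<open>m (Suc k) / m k\<close> increase;
  cross-multiply.\<close>

lemma log_convex_ratio_le:
  assumes lc: "log_convex m" and pos: "\<And>k. m k > 0" and "i \<le> j"
  shows "m (Suc i) * m j \<le> m i * m (Suc j)"
proof -
  have "m (Suc k) / m k \<le> m (Suc (Suc k)) / m (Suc k)" for k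
    using lc pos[of k] pos[of "Suc k"] by (simp add: log_convex_def divide_simps power2_eq_square mult_ac)
  then have "m (Suc i) / m i \<le> m (Suc j) / m j"
    using lift_Suc_mono_le[of "\<lambda>k. m (Suc k) / m k"] \<open>i \<le> j\<close> by blast
  then show ?thesis using pos[of i] pos[of j] by (simp add: divide_simps mult_ac)
qed

text \<open>Raising the left index multiplies by the ratio at \<open>a + 1\<close>, which is at most
  the ratio at \<open>a + b\<close> because \<open>b \<ge> 1\<close>. Splitting off
  \<open>m 1\<close> leaves an index one below the sum of the indices, and this gap later yields
  smallness.\<close>

lemma log_convex_mult_le:
  assumes lc: "log_convex m" and pos: "\<And>k. m k > 0" and "b \<ge> 1"
  shows "m (Suc a) * m b \<le> m 1 * m (a + b)"
proof (induction a)
  case (Suc a)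
  have r: "m (Suc (Suc a)) * m (a + b) \<le> m (Suc a) * m (Suc (a + b))"
    using log_convex_ratio_le[OF lc pos, of "Suc a" "a + b"] \<open>b \<ge> 1\<close> by simp
  have "m (Suc (Suc a)) * m b * m (a + b) \<le> m (Suc a) * m (Suc (a + b)) * m b"
    using mult_right_mono[OF r, of "m b"] pos[of b] by (simp add: mult_ac)
  also have "\<dots> \<le> m 1 * m (a + b) * m (Suc (a + b))"
    using mult_right_mono[OF Suc, of "m (Suc (a + b))"] pos[of "Suc (a + b)"] by (simp add: mult_ac)
  finally show ?case using pos[of "a + b"] by (simp add: mult_ac)
qed simp

text \<open>Ratios below |K| throughout would give \<open>m k \<le> |K|^k\<close>, against the root
  condition; a ratio that once reaches |K| stays there, since the ratios increase.\<close>

lemma log_convex_ratio_at_top: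
  assumes lc: "log_convex m" and pos: "\<And>k. m k > 0" and m0: "m 0 = 1"
    and lim: "filterlim (\<lambda>k. root k (m k)) at_top sequentially"
  shows "eventually (\<lambda>k. K * m k \<le> m (Suc k)) sequentially"
proof -
  have "\<exists>i. \<bar>K\<bar> * m i \<le> m (Suc i)"
  proof (rule ccontr)
    assume *: "\<not> ?thesis"
    have le: "m k \<le> \<bar>K\<bar> ^ k" for k
    proof (induction k)
      case (Suc k)
      have "m (Suc k) \<le> \<bar>K\<bar> * m k" using * by (meson less_imp_le not_le)
      also have "\<dots> \<le> \<bar>K\<bar> * \<bar>K\<bar> ^ k" using Suc by (intro mult_left_mono) auto
      finally show ?case by simp
    qed (simp add: m0)
    have "eventually (\<lambda>k. \<bar>K\<bar> + 1 \<le> root k (m k)) sequentially"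
      using lim by (simp add: filterlim_at_top)
    then obtain k where k: "k \<ge> 1" "\<bar>K\<bar> + 1 \<le> root k (m k)"
      unfolding eventually_sequentially by (metis nle_le)
    have "root k (m k) \<le> root k (\<bar>K\<bar> ^ k)" using le k by simp
    also have "\<dots> = \<bar>K\<bar>" using k by (intro real_root_power_cancel) auto
    finally show False using k by simp
  qed
  then obtain i where i: "\<bar>K\<bar> * m i \<le> m (Suc i)" by blast
  have "K * m j \<le> m (Suc j)" if "j \<ge> i" for j
  proof -
    have "\<bar>K\<bar> * m i * m j \<le> m (Suc i) * m j" using i pos[of j] by (intro mult_right_mono) auto
    also have "\<dots> \<le> m i * m (Suc j)" by (rule log_convex_ratio_le[OF lc pos that])
    finally have "\<bar>K\<bar> * m j \<le> m (Suc j)" using pos[of i] by (simp add: mult_ac)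
    moreover have "K * m j \<le> \<bar>K\<bar> * m j" using pos[of j] by (intro mult_right_mono) auto
    ultimately show ?thesis by linarith
  qed
  then show ?thesis by (auto simp: eventually_sequentially)
qed

lemma sum_half_powers_le: "(\<Sum>k=1..n. (1/2::real) ^ k) \<le> 1"
proof -
  have "(\<Sum>k=1..n. (1/2::real) ^ k) = 1 - (1/2) ^ n"
    by (induction n) auto
  then show ?thesis by simp
qed

text \<open>The recursion is that of the Taylor coefficients of a quotient whose denominator is at
  least \<open>\<delta>\<close> in modulus. \<open>B\<close> is fixed before the sequences, so it
  serves all points of an interval at once. The smaller scale \<open>\<sigma> / 2\<close> for
  \<open>a\<close> makes the sum geometric, and the growth of the ratios of \<open>m\<close> makes
  it small.\<close>

lemma quotient_recursion_bound:
  assumes lc: "log_convex m" and pos: "\<And>k. m k > 0" and m0: "m 0 = 1"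
    and lim: "filterlim (\<lambda>k. root k (m k)) at_top sequentially"
    and "\<delta> > 0" "A > 0" "\<sigma> > (0::real)"
  obtains B where "\<And>a d b n. (\<And>k. 0 \<le> a k \<and> a k \<le> A * (\<sigma> / 2) ^ k * m k) \<Longrightarrow>
    (\<And>k. d k \<le> A * \<sigma> ^ k * m k) \<Longrightarrow> (\<And>k. 0 \<le> b k) \<Longrightarrow>
    (\<And>n. \<delta> * b n \<le> d n + (\<Sum>k=1..n. a k * b (n - k))) \<Longrightarrow> b n \<le> B * \<sigma> ^ n * m n"
proof -
  define good where "good = (\<lambda>a d b :: nat \<Rightarrow> real.
    (\<forall>k. 0 \<le> a k \<and> a k \<le> A * (\<sigma> / 2) ^ k * m k) \<and>
    (\<forall>k. d k \<le> A * \<sigma> ^ k * m k) \<and> (\<forall>k. 0 \<le> b k) \<and>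
    (\<forall>n. \<delta> * b n \<le> d n + (\<Sum>k=1..n. a k * b (n - k))))"
  \<comment> \<open>\<open>w\<close> is the gain from log-convexity: 1 in crude estimates,
    \<open>\<delta> / (2 * A)\<close> for the middle terms at large \<open>n\<close>.\<close>
  have term_le: "a k * b (n - k) \<le> A * B * w * (1/2) ^ k * (\<sigma> ^ n * m n)"
    if "good a d b" "k \<le> n" "b (n - k) \<le> B * \<sigma> ^ (n - k) * m (n - k)"
      "m k * m (n - k) \<le> w * m n" "B \<ge> 0" for a d b k n B w
  proof -
    have "a k * b (n - k) \<le> (A * (\<sigma> / 2) ^ k * m k) * (B * \<sigma> ^ (n - k) * m (n - k))"
      using that assms pos unfolding good_def
      by (intro mult_mono) (auto intro!: mult_nonneg_nonneg simp: less_imp_le)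
    also have "\<dots> = A * B * (1/2) ^ k * \<sigma> ^ n * (m k * m (n - k))"
      using that(2) by (simp add: power_divide mult_ac flip: power_add)
    also have "\<dots> \<le> A * B * (1/2) ^ k * \<sigma> ^ n * (w * m n)"
      using that assms by (intro mult_left_mono) auto
    finally show ?thesis by (simp add: mult_ac)
  qed
  have pn: "\<sigma> ^ n * m n > 0" for n using assms pos by simp
  have prod_le: "m k * m (n - k) \<le> m n" if "k \<le> n" for k n
  proof -
    have "m k * m l \<le> m (k + l)" for k l
    proof (induction k)
      case (Suc k)
      have "m (Suc k) * m (k + l) \<le> m k * m (Suc (k + l))"
        by (rule log_convex_ratio_le[OF lc pos]) simp
      then have "m (Suc k) * m l * m (k + l) \<le> m k * m l * m (Suc (k + l))"
        using mult_right_mono[of _ _ "m l"] pos[of l] by (fastforce simp: mult_ac)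
      also have "\<dots> \<le> m (k + l) * m (Suc (k + l))"
        using Suc pos[of "Suc (k + l)"] by (intro mult_right_mono) auto
      finally show ?case using pos[of "k + l"] by (simp add: mult_ac)
    qed (simp add: m0)
    from this[of k "n - k"] show ?thesis using that by simp
  qed
  have sum_le: "(\<Sum>k\<in>I. c * (1/2) ^ k * e) \<le> c * e"
    if "I \<subseteq> {1..n}" "c \<ge> 0" "e \<ge> 0" for I n c and e :: real
  proof -
    have "(\<Sum>k\<in>I. (1/2::real) ^ k) \<le> (\<Sum>k=1..n. (1/2) ^ k)"
      using that by (intro sum_mono2) auto
    then have "c * e * (\<Sum>k\<in>I. (1/2::real) ^ k) \<le> c * e * 1"
      using that sum_half_powers_le[of n] by (intro mult_left_mono) auto
    then show ?thesis by (simp add: sum_distrib_left mult_ac)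
  qed
  \<comment> \<open>The constant may grow with \<open>N\<close>; this is harmless because
    \<open>N\<close> is later fixed independently of the sequences.\<close>
  have initial: "\<exists>B\<ge>0. \<forall>a d b. good a d b \<longrightarrow> (\<forall>n\<le>N. b n \<le> B * \<sigma> ^ n * m n)" for N
  proof (induction N)
    case 0
    have "b 0 \<le> A / \<delta>" if "good a d b" for a d b
      using that \<open>\<delta> > 0\<close> m0 unfolding good_def
      by (metis (no_types, lifting) add.right_neutral atLeastatMost_empty less_one
          mult.commute mult.right_neutral order_trans pos_le_divide_eq power_0 sum.empty)
    then show ?case using assms by (intro exI[of _ "A / \<delta>"]) (auto simp: m0)
  next
    case (Suc N)
    then obtain B where B: "B \<ge> 0" "\<And>a d b n. good a d b \<Longrightarrow> n \<le> N \<Longrightarrow> b n \<le> B * \<sigma> ^ n * m n"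
      by blast
    \<comment> \<open>At \<open>n = Suc N\<close>, \<open>d n\<close> contributes \<open>A\<close>
      and the sum at most \<open>A * B\<close>; then divide by \<open>\<delta>\<close>.\<close>
    define B' where "B' = B + (A + A * B) / \<delta>"
    have B': "B \<le> B'" "(A + A * B) / \<delta> \<le> B'" "0 \<le> B'" using B assms by (auto simp: B'_def)
    have "b n \<le> B' * \<sigma> ^ n * m n" if g: "good a d b" and n: "n \<le> Suc N" for a d b n
    proof (cases "n = Suc N")
      case False
      then have "b n \<le> B * (\<sigma> ^ n * m n)" using B(2)[OF g, of n] n by (simp add: mult_ac)
      also have "\<dots> \<le> B' * (\<sigma> ^ n * m n)" using B' less_imp_le[OF pn, of n] by (intro mult_right_mono) auto
      finally show ?thesis by (simp add: mult_ac)
    next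
      case True
      have "(\<Sum>k=1..n. a k * b (n - k)) \<le> (\<Sum>k=1..n. A * B * 1 * (1/2) ^ k * (\<sigma> ^ n * m n))"
        by (intro sum_mono term_le[OF g] B(2)[OF g]) (use True prod_le B in auto)
      also have "\<dots> \<le> A * B * 1 * (\<sigma> ^ n * m n)"
        by (rule sum_le[of _ n]) (use assms B less_imp_le[OF pn, of n] in auto)
      finally have "(\<Sum>k=1..n. a k * b (n - k)) \<le> A * B * (\<sigma> ^ n * m n)" by simp
      moreover have "\<delta> * b n \<le> d n + (\<Sum>k=1..n. a k * b (n - k))" "d n \<le> A * (\<sigma> ^ n * m n)"
        using g unfolding good_def by (auto simp: mult_ac)
      ultimately have "\<delta> * b n \<le> (A + A * B) * (\<sigma> ^ n * m n)"
        unfolding distrib_right by linarith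
      then have "b n \<le> (A + A * B) / \<delta> * (\<sigma> ^ n * m n)" using \<open>\<delta> > 0\<close> by (simp add: field_simps)
      also have "\<dots> \<le> B' * (\<sigma> ^ n * m n)" using B' less_imp_le[OF pn, of n] by (intro mult_right_mono) auto
      finally show ?thesis by (simp add: mult_ac)
    qed
    then show ?case using B' by blast
  qed
  \<comment> \<open>For \<open>n > N\<close> this says \<open>m 1 * m (n - 1) \<le> w * m n\<close>
    with the \<open>w\<close> defined below.\<close>
  obtain N where N: "\<And>k. k \<ge> N \<Longrightarrow> (2 * A * m 1 / \<delta>) * m k \<le> m (Suc k)"
    using log_convex_ratio_at_top[OF lc pos m0 lim] unfolding eventually_sequentially by blast
  obtain B0 where B0: "B0 \<ge> 0" "\<And>a d b n. good a d b \<Longrightarrow> n \<le> N \<Longrightarrow> b n \<le> B0 * \<sigma> ^ n * m n"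
    using initial[of N] by metis
  \<comment> \<open>Half of \<open>B * \<delta>\<close> will cover \<open>d n\<close> and the term
    \<open>k = n\<close>, the other half the terms with \<open>1 \<le> k < n\<close>.\<close>
  define B where "B = B0 + 2 * (A + A * B0) / \<delta>"
  have B: "B0 \<le> B" "2 * (A + A * B0) \<le> B * \<delta>" "0 \<le> B"
  proof -
    have "0 \<le> 2 * (A + A * B0) / \<delta>" using B0 assms by simp
    then show "B0 \<le> B" "0 \<le> B" using B0 by (auto simp: B_def)
    have "B * \<delta> = B0 * \<delta> + 2 * (A + A * B0)" using assms by (simp add: B_def field_simps)
    then show "2 * (A + A * B0) \<le> B * \<delta>" using B0 assms by simp
  qed
  define w where "w = \<delta> / (2 * A)"
  have w: "w \<ge> 0" using assms by (simp add: w_def)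
  have main: "b n \<le> B * \<sigma> ^ n * m n" if g: "good a d b" for a d b n
  proof (induction n rule: less_induct)
    case (less n)
    show ?case
    proof (cases "n \<le> N")
      case True
      then have "b n \<le> B0 * (\<sigma> ^ n * m n)" using B0(2)[OF g, of n] by (simp add: mult_ac)
      also have "\<dots> \<le> B * (\<sigma> ^ n * m n)" using B less_imp_le[OF pn, of n] by (intro mult_right_mono) auto
      finally show ?thesis by (simp add: mult_ac)
    next
      case False
      then have n: "n \<ge> 1" "n - 1 \<ge> N" by auto
      have wn: "m k * m (n - k) \<le> w * m n" if "k \<in> {1..<n}" for k
      proof -
        have "m k * m (n - k) \<le> m 1 * m (n - 1)"
        proof -
          have "1 \<le> n - k" using that by auto
          from log_convex_mult_le[OF lc pos this, of "k - 1"] show ?thesis using that by simp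
        qed
        also have "\<dots> \<le> w * m n"
          using N[OF n(2)] n assms by (simp add: w_def field_simps)
        finally show ?thesis .
      qed
      have "(\<Sum>k=1..<n. a k * b (n - k)) \<le> (\<Sum>k=1..<n. A * B * w * (1/2) ^ k * (\<sigma> ^ n * m n))"
        by (intro sum_mono term_le[OF g] less.IH wn) (use B in auto)
      also have "\<dots> \<le> A * B * w * (\<sigma> ^ n * m n)"
        by (rule sum_le[of _ n]) (use assms B w less_imp_le[OF pn, of n] in auto)
      also have "\<dots> = B * \<delta> / 2 * (\<sigma> ^ n * m n)" using assms by (simp add: w_def)
      finally have s1: "(\<Sum>k=1..<n. a k * b (n - k)) \<le> B * \<delta> / 2 * (\<sigma> ^ n * m n)" .
      \<comment> \<open>At \<open>k = n\<close> the product \<open>m n * m 0\<close> gains nothing,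
        so \<open>b 0\<close> is bounded by the earlier constant \<open>B0\<close>; this term stays
        independent of \<open>B\<close>.\<close>
      have "a n * b (n - n) \<le> A * B0 * 1 * (1/2) ^ n * (\<sigma> ^ n * m n)"
        by (rule term_le[OF g]) (use B0(2)[OF g, of 0] B0 m0 in auto)
      also have "\<dots> \<le> A * B0 * 1 * 1 * (\<sigma> ^ n * m n)"
        using assms B0 less_imp_le[OF pn, of n] by (intro mult_right_mono mult_left_mono) (auto simp: power_le_one)
      finally have s2: "a n * b 0 \<le> A * B0 * (\<sigma> ^ n * m n)" by simp
      have "{1..n} = insert n {1..<n}" using n by auto
      then have "(\<Sum>k=1..n. a k * b (n - k)) = a n * b 0 + (\<Sum>k=1..<n. a k * b (n - k))" by simp
      moreover have "\<delta> * b n \<le> d n + (\<Sum>k=1..n. a k * b (n - k))" "d n \<le> A * (\<sigma> ^ n * m n)"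
        using g unfolding good_def by (auto simp: mult_ac)
      ultimately have "\<delta> * b n \<le> (A + A * B0 + B * \<delta> / 2) * (\<sigma> ^ n * m n)"
        using s1 s2 unfolding distrib_right by linarith
      also have "\<dots> \<le> (B * \<delta>) * (\<sigma> ^ n * m n)"
        using B less_imp_le[OF pn, of n] by (intro mult_right_mono) auto
      finally show ?thesis using \<open>\<delta> > 0\<close> by (simp add: mult_ac)
    qed
  qed
  show ?thesis
  proof (rule that[of B])
    fix a d b :: "nat \<Rightarrow> real" and n
    assume "\<And>k. 0 \<le> a k \<and> a k \<le> A * (\<sigma> / 2) ^ k * m k" "\<And>k. d k \<le> A * \<sigma> ^ k * m k"
      "\<And>k. 0 \<le> b k" "\<And>n. \<delta> * b n \<le> d n + (\<Sum>k=1..n. a k * b (n - k))"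
    then have "good a d b" by (simp add: good_def)
    then show "b n \<le> B * \<sigma> ^ n * m n" by (rule main)
  qed
qed

text \<open>At each point the Taylor coefficients of \<open>H / G\<close> come from a quotient of
  formal power series. Solving the convolution identity for the top coefficient gives
  differentiability by induction, and taking norms gives the recursion for the bounds.\<close>

lemma ultra_jet_quotient:
  assumes G: "ultra_jet M R G" and H: "ultra_jet M R H" and M: "\<And>k. M k > 0" and M0: "M 0 = 1"
    and lc: "log_convex (\<lambda>k. M k / fact k)"
    and lim: "filterlim (\<lambda>k. root k (M k / fact k)) at_top sequentially"
    and \<delta>: "\<delta> > 0" "\<And>x. \<bar>x\<bar> < R \<Longrightarrow> \<delta> \<le> norm (G 0 x)"
  obtains Q where "ultra_jet M R Q" "\<And>x. \<bar>x\<bar> < R \<Longrightarrow> H 0 x = G 0 x * Q 0 x"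
proof -
  define m where "m = (\<lambda>k. M k / fact k)"
  define a where "a = (\<lambda>k x. G k x / fact k)"
  define d where "d = (\<lambda>k x. H k x / fact k)"
  define A where "A = (\<lambda>x. Abs_fps (\<lambda>k. a k x))"
  define D where "D = (\<lambda>x. Abs_fps (\<lambda>k. d k x))"
  define b where "b = (\<lambda>n x. fps_nth (D x * inverse (A x)) n)"
  have a0: "a 0 x \<noteq> 0" if "\<bar>x\<bar> < R" for x
    using \<delta> that by (force simp: a_def)
  have AB: "A x * Abs_fps (\<lambda>n. b n x) = D x" if "\<bar>x\<bar> < R" for x
  proof -
    have "Abs_fps (\<lambda>n. b n x) = D x * inverse (A x)" by (simp add: b_def fps_eq_iff)
    then show ?thesis
      using inverse_mult_eq_1[of "A x"] a0[OF that] by (simp add: A_def mult_ac)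
  qed
  have conv: "d n x = a 0 x * b n x + (\<Sum>k=1..n. a k x * b (n - k) x)" if "\<bar>x\<bar> < R" for n x
  proof -
    have "d n x = (\<Sum>k=0..n. a k x * b (n - k) x)"
      using arg_cong[OF AB[OF that], of "\<lambda>f. fps_nth f n"] by (simp add: fps_mult_nth A_def D_def)
    then show ?thesis by (simp add: sum.atLeast_Suc_atMost)
  qed
  \<comment> \<open>Coefficient \<open>n\<close> of the product rule for \<open>D = A B\<close>.
    Since \<open>a k\<close> has derivative \<open>(k + 1) a (k + 1)\<close>, the formal derivative
    in the series variable acts as the derivative in \<open>x\<close>.\<close>
  have conv': "of_nat (Suc n) * d (Suc n) x =
      a 0 x * (of_nat (Suc n) * b (Suc n) x) + of_nat 1 * a 1 x * b n x +
      (\<Sum>k=1..n. a k x * (of_nat (Suc (n - k)) * b (Suc (n - k)) x) + of_nat (Suc k) * a (Suc k) x * b (n - k) x)"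
    if "\<bar>x\<bar> < R" for n x
  proof -
    have "fps_nth (A x * fps_deriv (Abs_fps (\<lambda>n. b n x)) + fps_deriv (A x) * Abs_fps (\<lambda>n. b n x)) n
      = fps_nth (fps_deriv (D x)) n"
      unfolding AB[OF that, symmetric] by simp
    then have "of_nat (Suc n) * d (Suc n) x =
      (\<Sum>k=0..n. a k x * (of_nat (Suc (n - k)) * b (Suc (n - k)) x) + of_nat (Suc k) * a (Suc k) x * b (n - k) x)"
      by (simp add: fps_mult_nth A_def D_def sum.distrib)
    then show ?thesis by (simp add: sum.atLeast_Suc_atMost)
  qed
  have der_fact: "((\<lambda>x. F k x / fact k) has_vector_derivative of_nat (Suc k) * (F (Suc k) x / fact (Suc k))) (at x)"
    if "ultra_jet M R F" "\<bar>x\<bar> < R" for F k x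
    using has_vector_derivative_divide[OF ultra_jet_deriv[OF that, of k], of "fact k"]
    by (simp del: of_nat_Suc)
  have da: "(a k has_vector_derivative of_nat (Suc k) * a (Suc k) x) (at x)" if "\<bar>x\<bar> < R" for k x
    unfolding a_def by (rule der_fact[OF G that])
  have dd: "(d k has_vector_derivative of_nat (Suc k) * d (Suc k) x) (at x)" if "\<bar>x\<bar> < R" for k x
    unfolding d_def by (rule der_fact[OF H that])
  have db: "(b n has_vector_derivative of_nat (Suc n) * b (Suc n) x) (at x)" if x: "\<bar>x\<bar> < R" for n x
  proof (induction n rule: less_induct)
    case (less n)
    \<comment> \<open>\<open>N\<close> equals \<open>a 0 * b n\<close> but involves only
      coefficients of \<open>b\<close> below \<open>n\<close>, whose derivatives are known by
      induction.\<close>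
    define N where "N = (\<lambda>x. d n x - (\<Sum>k=1..n. a k x * b (n - k) x))"
    define N' where "N' = of_nat (Suc n) * d (Suc n) x - (\<Sum>k=1..n.
      a k x * (of_nat (Suc (n - k)) * b (Suc (n - k)) x) + of_nat (Suc k) * a (Suc k) x * b (n - k) x)"
    have dN: "(N has_vector_derivative N') (at x)"
      unfolding N_def N'_def
      by (intro has_vector_derivative_diff has_vector_derivative_sum has_vector_derivative_mult dd[OF x] da[OF x] less)
        auto
    have "((\<lambda>x. inverse (a 0 x)) has_vector_derivative (of_nat 1 * a 1 x) * - (inverse (a 0 x) ^ Suc (Suc 0))) (at x)"
      using field_vector_diff_chain_at[OF da[OF x, of 0] DERIV_inverse[OF a0[OF x]]]
      by (simp add: o_def)
    from has_vector_derivative_mult[OF dN this]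
    have "((\<lambda>x. N x * inverse (a 0 x)) has_vector_derivative
        N x * (of_nat 1 * a 1 x * - (inverse (a 0 x) ^ Suc (Suc 0))) + N' * inverse (a 0 x)) (at x)" .
    moreover have "N x * (of_nat 1 * a 1 x * - (inverse (a 0 x) ^ Suc (Suc 0))) + N' * inverse (a 0 x)
        = of_nat (Suc n) * b (Suc n) x"
    proof -
      have "N x = a 0 x * b n x" using conv[OF x, of n] by (simp add: N_def)
      moreover have "N' = a 0 x * (of_nat (Suc n) * b (Suc n) x) + a 1 x * b n x"
        using conv'[OF x, of n] by (simp add: N'_def)
      ultimately show ?thesis using a0[OF x] by (simp add: divide_simps)
    qed
    ultimately have "((\<lambda>x. N x * inverse (a 0 x)) has_vector_derivative of_nat (Suc n) * b (Suc n) x) (at x)"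
      by (simp only:)
    then show ?case
    proof (rule has_vector_derivative_transform_within_open[where S = "{-R<..<R}"])
      fix y assume "y \<in> {-R<..<R}"
      then have y: "\<bar>y\<bar> < R" by auto
      show "N y * inverse (a 0 y) = b n y"
        using conv[OF y, of n] a0[OF y] by (simp add: N_def)
    qed (use x in auto)
  qed
  define Q where "Q = (\<lambda>n x. fact n * b n x)"
  have dQ: "(Q n has_vector_derivative Q (Suc n) x) (at x)" if "\<bar>x\<bar> < R" for n x
    using has_vector_derivative_mult_right[OF db[OF that, of n], of "fact n"]
    by (simp add: Q_def mult_ac)
  have mpos: "m k > 0" for k using M by (simp add: m_def)
  have "ultra_jet M R Q"
    unfolding ultra_jet_def
  proof (intro conjI allI impI)
    fix \<sigma> :: real assume \<sigma>: "\<sigma> > 0"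
    \<comment> \<open>\<open>G\<close> supplies the convolution kernel, hence the scale
      \<open>\<sigma> / 2\<close>; for the numerator \<open>\<sigma>\<close> is enough.\<close>
    obtain C1 where C1: "C1 > 0" "\<And>k x. \<bar>x\<bar> < R \<Longrightarrow> norm (G k x) \<le> C1 * (\<sigma> / 2) ^ k * M k"
      using ultra_jet_bound[OF G, of "\<sigma> / 2"] \<sigma> M by (metis half_gt_zero)
    obtain C2 where C2: "C2 > 0" "\<And>k x. \<bar>x\<bar> < R \<Longrightarrow> norm (H k x) \<le> C2 * \<sigma> ^ k * M k"
      using ultra_jet_bound[OF H \<sigma>] M by metis
    define K where "K = C1 + C2"
    have K: "K > 0" "C1 \<le> K" "C2 \<le> K" using C1 C2 by (auto simp: K_def)
    have na: "norm (a k x) \<le> K * (\<sigma> / 2) ^ k * m k" if "\<bar>x\<bar> < R" for k x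
    proof -
      have "norm (a k x) \<le> C1 * ((\<sigma> / 2) ^ k * m k)"
        using C1(2)[OF that, of k] by (simp add: a_def m_def norm_divide divide_right_mono mult.assoc)
      also have "\<dots> \<le> K * ((\<sigma> / 2) ^ k * m k)"
        using K \<sigma> mpos[of k] by (intro mult_right_mono) auto
      finally show ?thesis by (simp add: mult.assoc)
    qed
    have nd: "norm (d k x) \<le> K * \<sigma> ^ k * m k" if "\<bar>x\<bar> < R" for k x
    proof -
      have "norm (d k x) \<le> C2 * (\<sigma> ^ k * m k)"
        using C2(2)[OF that, of k] by (simp add: d_def m_def norm_divide divide_right_mono mult.assoc)
      also have "\<dots> \<le> K * (\<sigma> ^ k * m k)"
        using K \<sigma> mpos[of k] by (intro mult_right_mono) auto
      finally show ?thesis by (simp add: mult.assoc)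
    qed
    have nb: "\<delta> * norm (b n x) \<le> norm (d n x) + (\<Sum>k=1..n. norm (a k x) * norm (b (n - k) x))"
      if x: "\<bar>x\<bar> < R" for n x
    proof -
      have "\<delta> * norm (b n x) \<le> norm (a 0 x) * norm (b n x)"
        using \<delta>(2)[OF x] by (intro mult_right_mono) (auto simp: a_def)
      also have "\<dots> = norm (d n x - (\<Sum>k=1..n. a k x * b (n - k) x))"
        using conv[OF x, of n] by (simp add: norm_mult)
      also have "\<dots> \<le> norm (d n x) + norm (\<Sum>k=1..n. a k x * b (n - k) x)"
        by (rule norm_triangle_ineq4)
      also have "norm (\<Sum>k=1..n. a k x * b (n - k) x) \<le> (\<Sum>k=1..n. norm (a k x) * norm (b (n - k) x))"
        by (rule order_trans[OF norm_sum]) (simp add: norm_mult)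
      finally show ?thesis by simp
    qed
    have lc': "log_convex m" and lim': "filterlim (\<lambda>k. root k (m k)) at_top sequentially" and m0: "m 0 = 1"
      using lc lim M0 by (simp_all add: m_def)
    show "\<exists>C. \<forall>k x. \<bar>x\<bar> < R \<longrightarrow> norm (Q k x) \<le> C * \<sigma> ^ k * M k"
    proof (rule quotient_recursion_bound[OF lc' mpos m0 lim' \<delta>(1) K(1) \<sigma>])
      fix B assume B: "\<And>a d b n. (\<And>k. 0 \<le> a k \<and> a k \<le> K * (\<sigma> / 2) ^ k * m k) \<Longrightarrow>
        (\<And>k. d k \<le> K * \<sigma> ^ k * m k) \<Longrightarrow> (\<And>k. 0 \<le> b k) \<Longrightarrow>
        (\<And>n. \<delta> * b n \<le> d n + (\<Sum>k=1..n. a k * b (n - k))) \<Longrightarrow> b n \<le> B * \<sigma> ^ n * m n"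
      have "norm (Q n x) \<le> B * \<sigma> ^ n * M n" if x: "\<bar>x\<bar> < R" for n x
      proof -
        have "norm (b n x) \<le> B * \<sigma> ^ n * m n"
          by (rule B[where a = "\<lambda>k. norm (a k x)" and d = "\<lambda>k. norm (d k x)"])
            (use na[OF x] nd[OF x] nb[OF x] in auto)
        then show ?thesis by (simp add: Q_def m_def norm_mult field_simps)
      qed
      then show "\<exists>C. \<forall>k x. \<bar>x\<bar> < R \<longrightarrow> norm (Q k x) \<le> C * \<sigma> ^ k * M k" by blast
    qed
  qed (use dQ in auto)
  moreover have "H 0 x = G 0 x * Q 0 x" if "\<bar>x\<bar> < R" for x
    using conv[OF that, of 0] by (simp add: d_def a_def Q_def)
  ultimately show ?thesis using that by blast
qed

section \<open>From two consecutive powers to the germ\<close>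

lemma isCont_eq_of_punctured_eq:
  fixes f g :: "real \<Rightarrow> complex"
  assumes "isCont f 0" "isCont g 0" "R > 0" "\<And>x. \<bar>x\<bar> < R \<Longrightarrow> x \<noteq> 0 \<Longrightarrow> f x = g x"
  shows "f 0 = g 0"
proof -
  have "eventually (\<lambda>x. f x = g x) (at 0)"
    unfolding eventually_at using assms(3,4) by (intro exI[of _ R]) auto
  then have "(f \<longlongrightarrow> g 0) (at 0)"
    using assms(2) tendsto_cong unfolding isCont_def by blast
  then show ?thesis
    using assms(1) unfolding isCont_def by (rule LIM_unique[rotated])
qed

text \<open>Induction on the order \<open>p\<close> of a nonvanishing derivative of \<open>G\<close>
  at 0: division by \<open>x\<close> lowers \<open>p\<close> and raises \<open>s\<close> by one. All
  regularity of \<open>f\<close> comes from \<open>G\<close> and \<open>H\<close>, as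
  \<open>f\<close> is an arbitrary function.\<close>

lemma germ_of_consecutive_powers:
  fixes f :: "real \<Rightarrow> complex"
  assumes M: "\<And>k. M k > 0" "M 0 = 1" "derivation_closed M"
    "log_convex (\<lambda>k. M k / fact k)"
    "filterlim (\<lambda>k. root k (M k / fact k)) at_top sequentially"
    and j: "j \<ge> 1" and R: "R > 0"
    and "ultra_jet M R G" "ultra_jet M R H" "G p 0 \<noteq> 0"
    and "\<And>x. \<bar>x\<bar> < R \<Longrightarrow> f x ^ j = of_real x ^ s * G 0 x"
    and "\<And>x. \<bar>x\<bar> < R \<Longrightarrow> f x ^ (j + 1) = of_real x ^ s * H 0 x"
  shows "f \<in> germs_E_M M"
proof -
  \<comment> \<open>Write \<open>(f^(j+1))^j = (f^j)^(j+1)\<close>, cancel \<open>x^(s j)\<close>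
    away from 0, and reach 0 by continuity. \<open>G\<close>, \<open>H\<close> and \<open>s\<close>
    are generic because the induction changes all three.\<close>
  have compat: "H 0 x ^ j = of_real x ^ s * G 0 x ^ (j + 1)"
    if G: "ultra_jet M R G" and H: "ultra_jet M R H"
      and fG: "\<And>x. \<bar>x\<bar> < R \<Longrightarrow> f x ^ j = of_real x ^ s * G 0 x"
      and fH: "\<And>x. \<bar>x\<bar> < R \<Longrightarrow> f x ^ (j + 1) = of_real x ^ s * H 0 x"
      and x: "\<bar>x\<bar> < R" for G H s x
  proof -
    have *: "H 0 x ^ j = of_real x ^ s * G 0 x ^ (j + 1)" if "\<bar>x\<bar> < R" "x \<noteq> 0" for x
    proof -
      have "(of_real x ^ s * H 0 x) ^ j = (of_real x ^ s * G 0 x) ^ (j + 1)"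
        unfolding fG[OF that(1), symmetric] fH[OF that(1), symmetric] by (simp only: mult.commute flip: power_mult)
      then have "(of_real x ^ s) ^ j * H 0 x ^ j = (of_real x ^ s) ^ j * (of_real x ^ s * G 0 x ^ (j + 1))"
        by (simp add: power_mult_distrib mult_ac)
      then show ?thesis using that by simp
    qed
    have "H 0 0 ^ j = of_real 0 ^ s * G 0 0 ^ (j + 1)"
      by (rule isCont_eq_of_punctured_eq[where R = R, OF _ _ R *])
        (use ultra_jet_isCont[OF G, of 0 0] ultra_jet_isCont[OF H, of 0 0] R in
          \<open>auto intro!: continuous_intros\<close>)
    with * x show ?thesis by (cases "x = 0") auto
  qed
  have quotient: ?thesis
    if G: "ultra_jet M R G" and H: "ultra_jet M R H" and G0: "G 0 0 \<noteq> 0"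
      and fG: "\<And>x. \<bar>x\<bar> < R \<Longrightarrow> f x ^ j = of_real x ^ s * G 0 x"
      and fH: "\<And>x. \<bar>x\<bar> < R \<Longrightarrow> f x ^ (j + 1) = of_real x ^ s * H 0 x" for G H s
  proof -
    have "isCont (\<lambda>x. norm (G 0 x)) 0"
      using ultra_jet_isCont[OF G, of 0 0] R by (intro continuous_intros) auto
    then have "((\<lambda>x. norm (G 0 x)) \<longlongrightarrow> norm (G 0 0)) (nhds 0)"
      unfolding isCont_def using tendsto_at_iff_tendsto_nhds[of "\<lambda>x. norm (G 0 x)" 0] by blast
    then have "eventually (\<lambda>x. norm (G 0 x) > norm (G 0 0) / 2) (nhds 0)"
      by (rule order_tendstoD(1)) (use G0 in simp)
    then obtain e where e: "e > 0" "\<And>x. \<bar>x\<bar> < e \<Longrightarrow> norm (G 0 x) > norm (G 0 0) / 2"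
      by (auto simp: eventually_nhds_metric)
    define r where "r = min R e"
    have r: "r > 0" "r \<le> R" "r \<le> e" using R e by (auto simp: r_def)
    obtain Q where Q: "ultra_jet M r Q" "\<And>x. \<bar>x\<bar> < r \<Longrightarrow> H 0 x = G 0 x * Q 0 x"
    proof (rule ultra_jet_quotient[OF ultra_jet_mono[OF G r(2)] ultra_jet_mono[OF H r(2)] M(1,2,4,5)])
      show "norm (G 0 0) / 2 > 0" using G0 by simp
      show "norm (G 0 0) / 2 \<le> norm (G 0 x)" if "\<bar>x\<bar> < r" for x
        using e(2)[of x] r that by simp
    qed blast
    have "f x = Q 0 x" if x: "\<bar>x\<bar> < r" for x
    proof -
      have xR: "\<bar>x\<bar> < R" and xe: "\<bar>x\<bar> < e" using x r by auto
      have Gx: "G 0 x \<noteq> 0" using e(2)[OF xe] by auto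
      show ?thesis
      \<comment> \<open>At \<open>x = 0\<close> with \<open>s > 0\<close> the factor
        \<open>x^s\<close> cannot be cancelled; there \<open>f\<close> and \<open>Q 0\<close> both
        vanish, the latter by \<open>compat\<close>.\<close>
      proof (cases "of_real x ^ s = (0 :: complex)")
        case False
        have "f x * (of_real x ^ s * G 0 x) = of_real x ^ s * (G 0 x * Q 0 x)"
          using fG[OF xR] fH[OF xR] Q(2)[OF x] by simp
        then show ?thesis using False Gx by auto
      next
        case True
        have "f x ^ j = 0" using fG[OF xR] unfolding True by simp
        moreover have "H 0 x ^ j = 0" using compat[OF G H fG fH xR] unfolding True by simp
        ultimately show ?thesis using Q(2)[OF x] Gx j by simp
      qed
    qed
    then show ?thesis using Q(1) r(1) germs_E_M_iff_ultra_jet[where M = M, OF M(1)] by blast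
  qed
  show ?thesis
    using assms(8-)
  proof (induction p arbitrary: G H s)
    case (Suc p G H s)
    note G = Suc.prems(1) and H = Suc.prems(2) and fG = Suc.prems(4) and fH = Suc.prems(5)
    show ?case
    proof (cases "G 0 0 = 0")
      case False
      with quotient[OF G H _ fG fH] show ?thesis by blast
    next
      case True
      \<comment> \<open>The relation \<open>H^j = x^s G^(j+1)\<close> at 0 makes \<open>H\<close>
        divisible along with \<open>G\<close>, even when \<open>s = 0\<close>.\<close>
      have "H 0 0 = 0"
        using compat[OF G H fG fH, of 0] True j R by simp
      then obtain H1 where H1: "ultra_jet M R H1" "\<And>x. \<bar>x\<bar> < R \<Longrightarrow> H 0 x = of_real x * H1 0 x"
        using ultra_jet_divide_x[OF H _ R M(1,3)] by metis
      obtain G1 where G1: "ultra_jet M R G1" "\<And>x. \<bar>x\<bar> < R \<Longrightarrow> G 0 x = of_real x * G1 0 x"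
        "\<And>k. G1 k 0 = G (Suc k) 0 / of_nat (Suc k)"
        using ultra_jet_divide_x[OF G True R M(1,3)] by metis
      \<comment> \<open>Division by \<open>x\<close> shifts the Taylor coefficients at 0 down by
        one.\<close>
      have "G1 p 0 \<noteq> 0" using G1(3)[of p] Suc.prems(3) by (simp del: of_nat_Suc)
      from Suc.IH[OF G1(1) H1(1) this, of "Suc s"] show ?thesis
        using fG fH G1(2) H1(2) by simp
    qed
  next
    case (0 G H s)
    then show ?case using quotient[of G H s] by blast
  qed
qed

theorem theorem2p6:
  fixes M :: "nat \<Rightarrow> real"
  assumes "weight_sequence M"
    and "quasianalytic M"
    and "derivation_closed M"
    and "log_convex (\<lambda>k. M k / fact k)"
    and "filterlim (\<lambda>k. root k (M k / fact k)) at_top sequentially"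
  shows "property_D (germs_E_M M)"
proof -
  obtain mu :: "nat \<Rightarrow> real" where mu: "\<And>k. 0 < mu k" "mono mu" and Mmu: "\<And>k. M k = (\<Prod>i\<in>{1..k}. mu i)"
    using assms(1) unfolding weight_sequence_def by blast
  have Mpos: "M k > 0" for k by (simp add: Mmu mu prod_pos)
  have M0: "M 0 = 1" by (simp add: Mmu)
  have MS: "M (Suc k) = mu (Suc k) * M k" for k by (simp add: Mmu prod.atLeast1_atMost_eq mult.commute)
  \<comment> \<open>The ratio \<open>M (Suc k) / M k\<close> in the definition is
    \<open>mu (Suc k)\<close>, so the sum starts at \<open>mu 1\<close>.\<close>
  have "\<not> summable (\<lambda>k. 1 / mu (Suc k))"
    using assms(2) Mpos by (simp add: quasianalytic_def MS less_imp_neq[THEN not_sym])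
  note dc = denjoy_carleman[OF _ M0 MS mu this]
  show ?thesis
    unfolding property_D_def
  proof (intro allI impI, elim conjE)
    fix f :: "real \<Rightarrow> complex" and j :: nat
    assume j: "1 \<le> j" and g: "(\<lambda>x. f x ^ j) \<in> germs_E_M M" and h: "(\<lambda>x. f x ^ (j + 1)) \<in> germs_E_M M"
    obtain R1 G where R1: "R1 > 0" and G: "ultra_jet M R1 G" "\<And>x. \<bar>x\<bar> < R1 \<Longrightarrow> f x ^ j = G 0 x"
      using g unfolding germs_E_M_iff_ultra_jet[where M = M, OF Mpos] by blast
    obtain R2 H where R2: "R2 > 0" and H: "ultra_jet M R2 H" "\<And>x. \<bar>x\<bar> < R2 \<Longrightarrow> f x ^ (j + 1) = H 0 x"
      using h unfolding germs_E_M_iff_ultra_jet[where M = M, OF Mpos] by blast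
    show "f \<in> germs_E_M M"
    proof (cases "\<exists>p. G p 0 \<noteq> 0")
      case True
      then obtain p where p: "G p 0 \<noteq> 0" by blast
      define R where "R = min R1 R2"
      have R: "R > 0" "R \<le> R1" "R \<le> R2" using R1 R2 by (auto simp: R_def)
      show ?thesis
        \<comment> \<open>No power of \<open>x\<close> has been factored out yet, hence
          \<open>s = 0\<close>.\<close>
        by (rule germ_of_consecutive_powers[where M = M, OF Mpos M0 assms(3-5) j R(1) ultra_jet_mono[OF G(1) R(2)]
              ultra_jet_mono[OF H(1) R(3)] p, where s = 0])
          (use G(2) H(2)[symmetric] R in auto)
    next
      case False
      \<comment> \<open>Flat case: \<open>f^j\<close> vanishes near 0 by uniqueness, hence so does
        \<open>f\<close>, and the zero jet represents it.\<close>
      then have "f x = 0" if "\<bar>x\<bar> < R1" for x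
        using dc[OF G(1) _ that] G(2)[OF that] by simp
      moreover have "ultra_jet M R1 (\<lambda>k x. 0)"
        using Mpos by (auto simp: ultra_jet_def intro!: exI[of _ 0])
      ultimately show ?thesis
        using R1 germs_E_M_iff_ultra_jet[where M = M, OF Mpos] by (metis (no_types, lifting))
    qed
  qed
qed

end
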